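(* Let $K\in\{\mathbb{R},\mathbb{C}\}$, let $A$ be a unitary algebra over $K$ with basis $\{e_0=1,e_1,\dots,e_n\}$, and for $m\in\mathbb{N}$ let $F_m=\sum_{k=0}^{n} f_{m+k}e_k\in A$, where $(f_j)$ is the Fibonacci sequence. Then the generating function $G(t)=\sum_{m=0}^{\infty}F_m t^m$ of the sequence $(F_m)_{m\in\mathbb{N}}$ is $$G(t)=\frac{F_0+(F_1-F_0)t}{1-t-t^2}.$$
   Context: The Fibonacci sequence is $f_0=0$, $f_1=1$, $f_j=f_{j-1}+f_{j-2}$ for $j\ge 2$. Here $\mathbb{N}=\{0,1,2,\dots\}$. The algebra $A$ is arbitrary with unit $e_0=1$: its multiplication is $K$-bilinear and is not assumed to be commutative or associative. The elements $F_m$ are called Fibonacci elements of $A$. The identity is one of formal power series in the variable $t$ with coefficients in $A$, where $1-t-t^2$ is a scalar power series in $K[[t]]$ (invertible there), and $A[[t]]$ is regarded as a $K[[t]]$-module. *)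

theory Defs
  imports "HOL-Number_Theory.Fib" "HOL-Computational_Algebra.Formal_Power_Series"
begin

text \<open>
  Neither associativity nor commutativity of \<open>mult\<close> is assumed, so the type classes for
  algebras in the library do not apply and the multiplication is an explicit parameter.
\<close>

locale unitary_algebra = vector_space scale
  for scale :: "'k::field \<Rightarrow> 'a::ab_group_add \<Rightarrow> 'a" +
  fixes mult :: "'a \<Rightarrow> 'a \<Rightarrow> 'a" and unit :: 'a
  assumes linear_mult_left: "Vector_Spaces.linear scale scale (\<lambda>x. mult x y)"
    and linear_mult_right: "Vector_Spaces.linear scale scale (\<lambda>y. mult x y)"
    and mult_unit_left: "mult unit x = x"
    and mult_unit_right: "mult x unit = x"

locale unitary_algebra_with_basis = unitary_algebra scale mult unit
  for scale :: "'k::field \<Rightarrow> 'a::ab_group_add \<Rightarrow> 'a"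
    and mult :: "'a \<Rightarrow> 'a \<Rightarrow> 'a" and unit :: 'a +
  fixes n :: nat and e :: "nat \<Rightarrow> 'a"
  assumes inj_basis: "inj_on e {..n}"
    and independent_basis: "independent (e ` {..n})"
    and span_basis: "span (e ` {..n}) = UNIV"
    and basis_0: "e 0 = unit"

definition fibonacci_element ::
    "('k::field \<Rightarrow> 'a::ab_group_add \<Rightarrow> 'a) \<Rightarrow> nat \<Rightarrow> (nat \<Rightarrow> 'a) \<Rightarrow> nat \<Rightarrow> 'a" where
  "fibonacci_element scale n e m = (\<Sum>k\<le>n. scale (of_nat (fib (m + k))) (e k))"

definition fibonacci_gen_fun ::
    "('k::field \<Rightarrow> 'a::ab_group_add \<Rightarrow> 'a) \<Rightarrow> nat \<Rightarrow> (nat \<Rightarrow> 'a) \<Rightarrow> 'a fps" where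
  "fibonacci_gen_fun scale n e = Abs_fps (fibonacci_element scale n e)"

text \<open>
  The action of \<open>K[[t]]\<close> on \<open>A[[t]]\<close> (Cauchy product); the multiplication of \<open>A\<close> plays no role.
\<close>

definition fps_scale ::
    "('k::field \<Rightarrow> 'a::ab_group_add \<Rightarrow> 'a) \<Rightarrow> 'k fps \<Rightarrow> 'a fps \<Rightarrow> 'a fps" where
  "fps_scale scale c g =
     Abs_fps (\<lambda>m. \<Sum>i\<le>m. scale (fps_nth c i) (fps_nth g (m - i)))"

text \<open>
  The quotient of a series in \<open>A[[t]]\<close> by a scalar series; it is meaningful only if the
  constant coefficient of \<open>d\<close> is nonzero, so that \<open>inverse d\<close> is the inverse of \<open>d\<close> in \<open>K[[t]]\<close>.
\<close>

definition fps_scale_divide ::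
    "('k::field \<Rightarrow> 'a::ab_group_add \<Rightarrow> 'a) \<Rightarrow> 'a fps \<Rightarrow> 'k fps \<Rightarrow> 'a fps" where
  "fps_scale_divide scale g d = fps_scale scale (inverse d) g"

end

theory Submission
  imports Defs
begin

text \<open>
  Multiplying the generating function \<open>G\<close> by \<open>1 - t - t\<^sup>2\<close> turns its \<open>m\<close>-th coefficient into
  \<open>F\<^sub>m - F\<^sub>m\<^sub>-\<^sub>1 - F\<^sub>m\<^sub>-\<^sub>2\<close>, where terms of negative index are dropped. The Fibonacci elements
  inherit the recurrence of the Fibonacci numbers, so this vanishes for \<open>m \<ge> 2\<close>
  (\<open>fibonacci_gen_fun_equation\<close>), and the coefficients \<open>F\<^sub>0\<close> and \<open>F\<^sub>1 - F\<^sub>0\<close> remain.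

  Dividing by \<open>1 - t - t\<^sup>2\<close> is legitimate because the Cauchy product makes \<open>A[[t]]\<close> a module
  over \<open>K[[t]]\<close>: associativity of the action (\<open>fps_scale_fps_scale\<close>) lets a scalar series with
  nonzero constant term be cancelled by its inverse (\<open>fps_scale_divide_unique\<close>).

  Real and complex scalars are treated together by arguing over a general field of scalars.
\<close>

context vector_space
begin

text \<open>
  Both sides collect the terms \<open>c\<^sub>i d\<^sub>j g\<^sub>k\<close> with \<open>i + j + k = m\<close>, so the reindexing behind
  associativity of the product of power series applies to this mixed product as well.
\<close>

lemma fps_scale_fps_scale:
  "fps_scale scale c (fps_scale scale d g) = fps_scale scale (c * d) g"
proof (rule fps_ext)
  fix m
  have "fps_nth (fps_scale scale (c * d) g) m =
      (\<Sum>j=0..m. \<Sum>i=0..j. scale (fps_nth c i) (scale (fps_nth d (j - i)) (fps_nth g (m - j))))"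
    by (simp add: fps_scale_def fps_mult_nth scale_sum_left atMost_atLeast0)
  also have "\<dots> = (\<Sum>j=0..m. \<Sum>i=0..m - j.
      scale (fps_nth c j) (scale (fps_nth d i) (fps_nth g (m - j - i))))"
    by (rule fps_mult_assoc_lemma)
  also have "\<dots> = fps_nth (fps_scale scale c (fps_scale scale d g)) m"
    by (simp add: fps_scale_def scale_sum_right atMost_atLeast0)
  finally show "fps_nth (fps_scale scale c (fps_scale scale d g)) m =
      fps_nth (fps_scale scale (c * d) g) m" ..
qed

lemma fps_scale_diff_left:
  "fps_scale scale (c - d) g = fps_scale scale c g - fps_scale scale d g"
  by (rule fps_ext) (simp add: fps_scale_def scale_left_diff_distrib sum_subtractf)

lemma fps_nth_fps_scale_X_power:
  "fps_nth (fps_scale scale (fps_X ^ k) g) m = (if m < k then 0 else fps_nth g (m - k))"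
proof -
  have "fps_nth (fps_scale scale (fps_X ^ k) g) m =
      (\<Sum>i\<le>m. if i = k then fps_nth g (m - i) else 0)"
    by (simp add: fps_scale_def fps_X_power_nth if_distrib [of "\<lambda>c. scale c _"] cong: if_cong)
  then show ?thesis
    by simp
qed

lemma fps_nth_fps_scale_X:
  "fps_nth (fps_scale scale fps_X g) m = (if m = 0 then 0 else fps_nth g (m - 1))"
  using fps_nth_fps_scale_X_power [of 1 g m] by simp

lemma fps_scale_one: "fps_scale scale 1 g = g"
  using fps_nth_fps_scale_X_power [of 0 g] by (intro fps_ext) simp

lemma fps_scale_divide_unique:
  assumes "fps_nth d 0 \<noteq> 0" and "fps_scale scale d g = h"
  shows "g = fps_scale_divide scale h d"
proof -
  have "fps_scale_divide scale h d = fps_scale scale (inverse d * d) g"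
    by (simp add: fps_scale_divide_def fps_scale_fps_scale flip: assms(2))
  then show ?thesis
    by (simp add: inverse_mult_eq_1 [OF assms(1)] fps_scale_one)
qed

lemma fibonacci_element_Suc_Suc:
  "fibonacci_element scale n e (Suc (Suc m)) =
     fibonacci_element scale n e (Suc m) + fibonacci_element scale n e m"
  by (simp add: fibonacci_element_def scale_left_distrib sum.distrib)

lemma fibonacci_gen_fun_equation:
  "fps_scale scale (1 - fps_X - fps_X ^ 2) (fibonacci_gen_fun scale n e) =
     fps_const (fibonacci_element scale n e 0) +
     fps_scale scale fps_X
       (fps_const (fibonacci_element scale n e 1 - fibonacci_element scale n e 0))"
proof (rule fps_ext)
  fix m
  \<comment> \<open>The coefficients of \<open>t\<^sup>0\<close> and \<open>t\<^sup>1\<close> precede the recurrence and give the numerator.\<close>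
  consider "m = 0" | "m = 1" | k where "m = Suc (Suc k)"
    by (metis One_nat_def not0_implies_Suc)
  then show "fps_nth (fps_scale scale (1 - fps_X - fps_X ^ 2) (fibonacci_gen_fun scale n e)) m =
      fps_nth (fps_const (fibonacci_element scale n e 0) +
        fps_scale scale fps_X
          (fps_const (fibonacci_element scale n e 1 - fibonacci_element scale n e 0))) m"
    by cases
      (simp_all add: fps_scale_diff_left fps_scale_one fps_nth_fps_scale_X
        fps_nth_fps_scale_X_power fibonacci_gen_fun_def fibonacci_element_Suc_Suc)
qed

theorem fibonacci_gen_fun_closed_form:
  "fibonacci_gen_fun scale n e =
     fps_scale_divide scale
       (fps_const (fibonacci_element scale n e 0) +
        fps_scale scale fps_X
          (fps_const (fibonacci_element scale n e 1 - fibonacci_element scale n e 0)))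
       (1 - fps_X - fps_X ^ 2)"
  by (rule fps_scale_divide_unique [OF _ fibonacci_gen_fun_equation]) simp

end

theorem theorem2p5:
  fixes scale_real :: "real \<Rightarrow> 'a::ab_group_add \<Rightarrow> 'a"
    and scale_complex :: "complex \<Rightarrow> 'a \<Rightarrow> 'a"
    and mult :: "'a \<Rightarrow> 'a \<Rightarrow> 'a" and unit :: 'a
    and n :: nat and e :: "nat \<Rightarrow> 'a"
  shows "(unitary_algebra_with_basis scale_real mult unit n e \<longrightarrow>
           fibonacci_gen_fun scale_real n e =
             fps_scale_divide scale_real
               (fps_const (fibonacci_element scale_real n e 0) +
                fps_scale scale_real fps_X
                  (fps_const (fibonacci_element scale_real n e 1 -
                              fibonacci_element scale_real n e 0)))
               (1 - fps_X - fps_X ^ 2))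
       \<and> (unitary_algebra_with_basis scale_complex mult unit n e \<longrightarrow>
           fibonacci_gen_fun scale_complex n e =
             fps_scale_divide scale_complex
               (fps_const (fibonacci_element scale_complex n e 0) +
                fps_scale scale_complex fps_X
                  (fps_const (fibonacci_element scale_complex n e 1 -
                              fibonacci_element scale_complex n e 0)))
               (1 - fps_X - fps_X ^ 2))"
  by (intro conjI impI vector_space.fibonacci_gen_fun_closed_form)
    (simp_all add: unitary_algebra_with_basis_def unitary_algebra_def)

end
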